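(* Let $k$ and $n$ be positive integers, let $t, m$ be non-negative integers, let $a_1,\dots,a_k$ be non-negative integers, and write $q := \sum_{i \in [k]} a_i$. Let $V_1, \dots, V_k$ be disjoint sets of vertices each of size $n$. Let $H_1, \dots, H_t$ be $k$-partite $k$-graphs each with vertex classes $V_1, \dots, V_k$, and suppose that (i) for each $i \in [k]$ and $j \in [t]$ we have $\delta_{[k]\setminus\{i\}}(H_j) \geq a_i$, and (ii) each crossing $k$-tuple appears in at least $m$ of the $k$-graphs $H_j$ (that is, is an edge of $H_j$ for at least $m$ indices $j\in[t]$). If $n \geq \max(1600k^4q, 100k^6)$ and $m+q \leq t \leq \left(1+\frac{1}{200k}\right)q$, then the family $\mathcal{H} :=\{H_1, \dots, H_t\}$ admits a rainbow matching of size $m+q$.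
   Context: $[k]=\{1,\dots,k\}$. A $k$-graph (i.e. $k$-uniform hypergraph) $H$ consists of a finite vertex set and an edge set $E(H)$, each edge being a set of $k$ vertices. It is $k$-partite with vertex classes $V_1,\dots,V_k$ if its vertex set is the disjoint union of $V_1,\dots,V_k$ and every edge has precisely one vertex in each $V_i$. A set of vertices is crossing if it has at most one vertex in each vertex class, and it avoids $V_i$ if it is disjoint from $V_i$. A crossing $s$-tuple is a crossing set of $s$ vertices. For a crossing $(k-1)$-tuple $S$, $\deg_H(S)$ is the number of edges $e\in E(H)$ with $S\subseteq e$, and $\delta_{[k]\setminus\{i\}}(H)$ is the minimum of $\deg_H(S)$ over all crossing $(k-1)$-tuples $S$ which avoid $V_i$. Families $\{H_1,\dots,H_t\}$ are indexed families (the $H_j$ need not be distinct). A rainbow matching in $\{H_1,\dots,H_t\}$ is a set $M$ of pairwise-disjoint $k$-tuples of vertices for which there is an injective map $\phi: M\to[t]$ with $e\in E(H_{\phi(e)})$ for every $e\in M$. *)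

theory Defs
  imports Complex_Main "HOL-Library.Disjoint_Sets"
begin

record 'a hypergraph =
  verts :: "'a set"
  edges :: "'a set set"

definition k_graph :: "nat \<Rightarrow> 'a hypergraph \<Rightarrow> bool" where
  "k_graph k H \<longleftrightarrow>
     finite (verts H) \<and> (\<forall>e\<in>edges H. e \<subseteq> verts H \<and> card e = k)"

text \<open>The vertex classes are given by a function \<open>V\<close>, of which only the values
  \<open>V 1, \<dots>, V k\<close> matter.\<close>

definition class_union :: "nat \<Rightarrow> (nat \<Rightarrow> 'a set) \<Rightarrow> 'a set" where
  "class_union k V = (\<Union>i\<in>{1..k}. V i)"

definition k_partite :: "nat \<Rightarrow> (nat \<Rightarrow> 'a set) \<Rightarrow> 'a hypergraph \<Rightarrow> bool" where
  "k_partite k V H \<longleftrightarrow>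
     verts H = class_union k V \<and> disjoint_family_on V {1..k} \<and>
     (\<forall>e\<in>edges H. \<forall>i\<in>{1..k}. card (e \<inter> V i) = 1)"

definition crossing :: "nat \<Rightarrow> (nat \<Rightarrow> 'a set) \<Rightarrow> 'a set \<Rightarrow> bool" where
  "crossing k V S \<longleftrightarrow>
     finite S \<and> S \<subseteq> class_union k V \<and> (\<forall>i\<in>{1..k}. card (S \<inter> V i) \<le> 1)"

definition crossing_tuples :: "nat \<Rightarrow> (nat \<Rightarrow> 'a set) \<Rightarrow> nat \<Rightarrow> 'a set set" where
  "crossing_tuples k V s = {S. crossing k V S \<and> card S = s}"

definition avoids :: "'a set \<Rightarrow> 'a set \<Rightarrow> bool" where
  "avoids S W \<longleftrightarrow> S \<inter> W = {}"

definition hdeg :: "'a hypergraph \<Rightarrow> 'a set \<Rightarrow> nat" where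
  "hdeg H S = card {e \<in> edges H. S \<subseteq> e}"

text \<open>\<open>min_deg_avoiding k V i H\<close> is $\delta_{[k]\setminus\{i\}}(H)$. The minimum is over a finite
  nonempty set whenever \<open>k \<ge> 1\<close> and the classes are disjoint, finite and nonempty; for
  \<open>k = 1\<close> the only tuple is the empty set.\<close>

definition min_deg_avoiding ::
  "nat \<Rightarrow> (nat \<Rightarrow> 'a set) \<Rightarrow> nat \<Rightarrow> 'a hypergraph \<Rightarrow> nat" where
  "min_deg_avoiding k V i H =
     Min {hdeg H S | S. S \<in> crossing_tuples k V (k - 1) \<and> avoids S (V i)}"

text \<open>The family is \<open>H 1, \<dots>, H t\<close>, indexed and hence possibly with repetitions; \<open>X\<close> is
  the common vertex set.\<close>

definition rainbow_matching ::
  "nat \<Rightarrow> 'a set \<Rightarrow> nat \<Rightarrow> (nat \<Rightarrow> 'a hypergraph) \<Rightarrow> 'a set set \<Rightarrow> bool" where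
  "rainbow_matching k X t H M \<longleftrightarrow>
     (\<forall>e\<in>M. e \<subseteq> X \<and> card e = k) \<and> pairwise disjnt M \<and>
     (\<exists>\<phi>. inj_on \<phi> M \<and> \<phi> ` M \<subseteq> {1..t} \<and> (\<forall>e\<in>M. e \<in> edges (H (\<phi> e))))"

end

theory Submission
  imports Defs
begin

text \<open>Take a rainbow matching of maximum size \<open>s\<close> and suppose \<open>s < m + q\<close>. Split the \<open>n - s\<close> uncovered
  vertices of each class into disjoint transversals (rows). If the vertex \<open>u\<close> of a matching edge
  extends many rows in an unused colour, this colour can take over \<open>u\<close> and so free the colour of
  the edge, which then may do the same elsewhere. By maximality no colour freed in this way has an
  uncovered edge, so by the degree condition it sees at least \<open>q\<close> covered vertices per row. A row
  is a \<open>k\<close>-tuple, so at least \<open>m\<close> colours do have uncovered edges; again by maximality a freed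
  colour sees almost nothing at their matching edges, nor at those already switched. It thus
  collects \<open>q\<close> per row from at most \<open>q - 1\<close> matching edges, so at some new edge it sees two vertices
  in many rows. This prolongs the switching sequence forever, which is impossible. The second vertex
  is needed because a freed colour seeing the vertex used at an earlier edge could otherwise not be
  placed there.\<close>

section \<open>Rainbow families and distinct representatives\<close>

text \<open>Indexing the edges by their colours, instead of colouring a set of edges, turns
  switching into a redefinition of \<open>e\<close>; the size to be maximised is
  \<open>card D\<close>.\<close>

definition rainbow_family ::
  "nat \<Rightarrow> (nat \<Rightarrow> 'a set set) \<Rightarrow> nat set \<Rightarrow> (nat \<Rightarrow> 'a set) \<Rightarrow> bool" where
  "rainbow_family t E D e \<longleftrightarrow>
     D \<subseteq> {1..t} \<and> (\<forall>c\<in>D. e c \<in> E c) \<and> disjoint_family_on e D"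

text \<open>Choosing in order, at most \<open>card F + i\<close> elements are forbidden when index
  \<open>i\<close> is reached. This later yields distinct rows for simultaneous switches, with
  \<open>F\<close> the rows that meet an uncovered edge.\<close>

lemma greedy_distinct_representatives:
  fixes A :: "nat \<Rightarrow> 'b set"
  assumes "finite F" and "\<And>i. i < L \<Longrightarrow> card F + i < card (A i)"
  shows "\<exists>r. inj_on r {..<L} \<and> (\<forall>i<L. r i \<in> A i - F)"
  using assms(2)
proof (induction L)
  case 0
  then show ?case by auto
next
  case (Suc L)
  then obtain r where r: "inj_on r {..<L}" "\<forall>i<L. r i \<in> A i - F"
    by (metis less_Suc_eq)
  have "card (F \<union> r ` {..<L}) \<le> card F + card (r ` {..<L})"
    by (rule card_Un_le)
  also have "\<dots> \<le> card F + L"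
    using card_image_le[of "{..<L}" r] by simp
  also have "\<dots> < card (A L)"
    using Suc.prems[of L] by simp
  finally have "\<not> A L \<subseteq> F \<union> r ` {..<L}"
    using card_mono[of "F \<union> r ` {..<L}" "A L"] assms(1) by force
  then obtain z where z: "z \<in> A L" "z \<notin> F" "z \<notin> r ` {..<L}"
    by blast
  have "inj_on (r(L := z)) {..<Suc L}"
    using r(1) z(3) by (auto simp: inj_on_def less_Suc_eq)
  moreover have "\<forall>i<Suc L. (r(L := z)) i \<in> A i - F"
    using r(2) z by (auto simp: less_Suc_eq)
  ultimately show ?case by blast
qed

section \<open>Rows of uncovered vertices and switches\<close>

text \<open>Every matching edge takes one vertex of each class, so the same number \<open>w\<close>
  is left in all classes and the enumerations \<open>g i\<close> can be read in parallel: the values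
  \<open>g i r\<close> for fixed \<open>r\<close> form a row.\<close>

locale maximum_rainbow =
  fixes k t w :: nat
    and V :: "nat \<Rightarrow> 'a set"
    and E :: "nat \<Rightarrow> 'a set set"
    and D :: "nat set"
    and e :: "nat \<Rightarrow> 'a set"
    and g :: "nat \<Rightarrow> nat \<Rightarrow> 'a"
  assumes disj_V: "disjoint_family_on V {1..k}"
    and fin_V: "\<And>i. i \<in> {1..k} \<Longrightarrow> finite (V i)"
    and edge_sub: "\<And>c f. c \<in> {1..t} \<Longrightarrow> f \<in> E c \<Longrightarrow> f \<subseteq> class_union k V"
    and edge_V: "\<And>c f i. c \<in> {1..t} \<Longrightarrow> f \<in> E c \<Longrightarrow> i \<in> {1..k} \<Longrightarrow> card (f \<inter> V i) = 1"
    and edge_card: "\<And>c f. c \<in> {1..t} \<Longrightarrow> f \<in> E c \<Longrightarrow> card f = k"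
    and rainbow: "rainbow_family t E D e"
    and maximal: "\<And>D' e'. rainbow_family t E D' e' \<Longrightarrow> card D' \<le> card D"
    and g_bij: "\<And>i. i \<in> {1..k} \<Longrightarrow> bij_betw (g i) {..<w} (V i - \<Union> (e ` D))"
begin

abbreviation covered :: "'a set" where
  "covered \<equiv> \<Union> (e ` D)"

text \<open>For \<open>u \<in> V j\<close> this is the transversal \<open>{g 1 r, \<dots>, g k r}\<close> with its vertex in \<open>V j\<close>
  replaced by \<open>u\<close>.\<close>

definition switch :: "'a \<Rightarrow> nat \<Rightarrow> 'a set" where
  "switch u r = insert u {g i r |i. i \<in> {1..k} \<and> u \<notin> V i}"

text \<open>The size of this set acts as a degree of \<open>u\<close> in colour \<open>c\<close>.
  Only edges completing \<open>u\<close> by a row are counted, since these are disjoint for distinct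
  covered vertices and distinct rows.\<close>

definition rows :: "nat \<Rightarrow> 'a \<Rightarrow> nat set" where
  "rows c u = {r \<in> {..<w}. switch u r \<in> E c}"

lemma card_rows_le: "card (rows c u) \<le> w"
proof -
  have "rows c u \<subseteq> {..<w}"
    by (auto simp: rows_def)
  from card_mono[OF _ this] show ?thesis by simp
qed

lemma g_mem: "i \<in> {1..k} \<Longrightarrow> r < w \<Longrightarrow> g i r \<in> V i - covered"
  using g_bij[of i] by (auto simp: bij_betw_def)

lemma V_unique: "i \<in> {1..k} \<Longrightarrow> j \<in> {1..k} \<Longrightarrow> z \<in> V i \<Longrightarrow> z \<in> V j \<Longrightarrow> i = j"
  using disj_V unfolding disjoint_family_on_def by blast

lemma g_eqD:
  assumes "g i r = g i' r'" "i \<in> {1..k}" "i' \<in> {1..k}" "r < w" "r' < w"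
  shows "i = i' \<and> r = r'"
proof -
  have "i = i'"
    using V_unique[of i i' "g i r"] g_mem[of i r] g_mem[of i' r'] assms by auto
  then show ?thesis
    using assms g_bij[of i] by (auto simp: bij_betw_def inj_on_def)
qed

lemma D_sub: "D \<subseteq> {1..t}" and e_edge: "c \<in> D \<Longrightarrow> e c \<in> E c"
  and e_disj: "c \<in> D \<Longrightarrow> c' \<in> D \<Longrightarrow> z \<in> e c \<Longrightarrow> z \<in> e c' \<Longrightarrow> c = c'"
  using rainbow unfolding rainbow_family_def disjoint_family_on_def by blast+

lemma finite_D: "finite D"
  using D_sub finite_subset by blast

lemma finite_edge: "c \<in> {1..t} \<Longrightarrow> f \<in> E c \<Longrightarrow> finite f"
  using edge_sub[of c f] fin_V by (auto simp: class_union_def intro: finite_subset)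

text \<open>Rows are pairwise disjoint, so sending each row that meets \<open>f\<close> to a vertex
  of \<open>f\<close> in it is injective.\<close>

lemma card_rows_meeting:
  assumes "finite f"
  shows "card {r \<in> {..<w}. \<exists>i\<in>{1..k}. g i r \<in> f} \<le> card f"
proof -
  let ?F = "{r \<in> {..<w}. \<exists>i\<in>{1..k}. g i r \<in> f}"
  have "\<forall>r\<in>?F. \<exists>i. i \<in> {1..k} \<and> g i r \<in> f" by auto
  then obtain h where h: "\<forall>r\<in>?F. h r \<in> {1..k} \<and> g (h r) r \<in> f"
    by (rule bchoice[THEN exE])
  have "inj_on (\<lambda>r. g (h r) r) ?F"
  proof (rule inj_onI)
    fix r r' assume "r \<in> ?F" "r' \<in> ?F" "g (h r) r = g (h r') r'"
    then show "r = r'" using g_eqD[of "h r" r "h r'" r'] h by auto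
  qed
  moreover have "(\<lambda>r. g (h r) r) ` ?F \<subseteq> f" using h by auto
  ultimately show ?thesis using assms by (rule card_inj_on_le)
qed

lemma switch_cases:
  assumes "z \<in> switch u r" "r < w"
  obtains "z = u" | i where "i \<in> {1..k}" "z = g i r" "z \<notin> covered"
  using assms g_mem[of _ r] unfolding switch_def by blast

lemma switch_covered:
  assumes "z \<in> switch u r" "z \<in> covered" "r < w"
  shows "z = u"
  using assms by (elim switch_cases) auto

text \<open>Rows consist of uncovered vertices, so neither \<open>u\<close> nor \<open>u'\<close>
  lies in a row, and distinct rows share no vertex.\<close>

lemma switch_disjoint_switch:
  assumes "u \<in> covered" "u' \<in> covered" "u \<noteq> u'" "r < w" "r' < w" "r \<noteq> r'"
  shows "switch u r \<inter> switch u' r' = {}"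
proof (rule ccontr)
  assume "switch u r \<inter> switch u' r' \<noteq> {}"
  then obtain z where z: "z \<in> switch u r" "z \<in> switch u' r'"
    by blast
  show False
    using z(1) \<open>r < w\<close>
  proof (cases rule: switch_cases)
    case 1
    then show False
      using switch_covered[OF z(2)] assms by blast
  next
    case (2 i)
    show False
      using z(2) \<open>r' < w\<close>
    proof (cases rule: switch_cases)
      case 1
      then show False using 2 assms by blast
    next
      case (2 j)
      then show False using \<open>z = g i r\<close> \<open>i \<in> {1..k}\<close> g_eqD[of i r j r'] assms by auto
    qed
  qed
qed

text \<open>The colours \<open>x i\<close> take over the vertices \<open>u i\<close>, each completed by a row of its own, and the
  at most one colour in \<open>Y\<close> takes the uncovered edge \<open>f\<close>.\<close>

lemma no_augmentation:
  assumes x: "inj_on x {..<L}" "\<And>i. i < L \<Longrightarrow> x i \<in> {1..t}"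
    and u: "inj_on u {..<L}"
    and u_in: "\<And>i. i < L \<Longrightarrow> \<exists>y\<in>(x ` {..<L} \<union> Y) \<inter> D. u i \<in> e y"
    and many: "\<And>i. i < L \<Longrightarrow> k + i < card (rows (x i) (u i))"
    and Y: "Y \<subseteq> {y}"
    and f: "f \<inter> covered = {}" "finite f" "card f \<le> k" "\<And>y. y \<in> Y \<Longrightarrow> y \<in> {1..t} \<and> f \<in> E y"
  shows "x ` {..<L} \<union> Y \<subseteq> D"
proof (rule ccontr)
  assume new: "\<not> x ` {..<L} \<union> Y \<subseteq> D"
  \<comment> \<open>Avoiding these rows keeps the switches disjoint from \<open>f\<close>. The
    summand \<open>k\<close> in \<open>many\<close> pays for them, the summand \<open>i\<close> for
    the rows taken by earlier switches.\<close>
  define F where "F = {r \<in> {..<w}. \<exists>i\<in>{1..k}. g i r \<in> f}"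
  have "card F \<le> k"
    unfolding F_def using card_rows_meeting[OF f(2)] f(3) by simp
  then have "card F + i < card (rows (x i) (u i))" if "i < L" for i
    using many[OF that] by linarith
  then have "\<exists>r. inj_on r {..<L} \<and> (\<forall>i<L. r i \<in> rows (x i) (u i) - F)"
    by (intro greedy_distinct_representatives) (auto simp: F_def)
  then obtain r where r: "inj_on r {..<L}" "\<And>i. i < L \<Longrightarrow> r i \<in> rows (x i) (u i) - F"
    by blast
  have r_w: "r i < w" if "i < L" for i
    using r(2)[OF that] by (auto simp: rows_def)
  have u_cov: "u i \<in> covered" if "i < L" for i
    using u_in[OF that] by blast
  \<comment> \<open>Testing \<open>Y\<close> first settles the case that its colour is also some
    \<open>x i\<close>: it then takes \<open>f\<close>, and the switch at \<open>u i\<close> is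
    dropped.\<close>
  define e' where "e' c = (if c \<in> Y then f else if c \<in> x ` {..<L}
    then switch (u (the_inv_into {..<L} x c)) (r (the_inv_into {..<L} x c)) else e c)" for c
  have e'_x: "e' (x i) = switch (u i) (r i)" if "i < L" "x i \<notin> Y" for i
    using that x(1) by (simp add: e'_def the_inv_into_f_f)
  let ?D = "D \<union> (x ` {..<L} \<union> Y)"
  have kinds: "c \<in> Y \<and> e' c = f \<or> (\<exists>i<L. c = x i \<and> c \<notin> Y \<and> e' c = switch (u i) (r i))
      \<or> c \<in> D - (x ` {..<L} \<union> Y) \<and> e' c = e c" if "c \<in> ?D" for c
    using that e'_x by (auto simp: e'_def)
  have f_switch: "f \<inter> switch (u i) (r i) = {}" if "i < L" for i
    using r(2)[OF that] u_cov[OF that] f(1) r_w[OF that] by (auto simp: switch_def F_def)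
  \<comment> \<open>By \<open>u_in\<close> the old edge through \<open>u i\<close> belongs to a
    colour that receives a new edge, so no edge that is kept contains \<open>u i\<close>.\<close>
  have e_switch: "e c \<inter> switch (u i) (r i) = {}" if "i < L" "c \<in> D - (x ` {..<L} \<union> Y)" for i c
  proof -
    obtain y where y: "y \<in> (x ` {..<L} \<union> Y) \<inter> D" "u i \<in> e y"
      using u_in \<open>i < L\<close> by blast
    show ?thesis
    proof (rule ccontr)
      assume "e c \<inter> switch (u i) (r i) \<noteq> {}"
      then obtain z where "z \<in> e c" "z \<in> switch (u i) (r i)" by blast
      moreover from this have "z = u i"
        using switch_covered[of z "u i" "r i"] that r_w by blast
      ultimately have "c = y" using e_disj[of c y "u i"] y that by blast
      then show False using y that by blast
    qed
  qed
  have switch_switch: "switch (u i) (r i) \<inter> switch (u j) (r j) = {}" if "i < L" "j < L" "i \<noteq> j" for i j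
    using that u r(1) u_cov r_w by (intro switch_disjoint_switch) (auto simp: inj_on_def)
  have "rainbow_family t E ?D e'"
    unfolding rainbow_family_def
  proof (intro conjI ballI)
    show "?D \<subseteq> {1..t}"
      using D_sub x(2) f(4) by blast
  next
    fix c assume "c \<in> ?D"
    from kinds[OF this] show "e' c \<in> E c"
    proof (elim disjE exE conjE)
      assume "c \<in> Y" "e' c = f"
      then show ?thesis using f(4) by simp
    next
      fix i assume "i < L" "c = x i" "e' c = switch (u i) (r i)"
      then show ?thesis using r(2)[of i] by (simp add: rows_def)
    next
      assume "c \<in> D - (x ` {..<L} \<union> Y)" "e' c = e c"
      then show ?thesis using e_edge by simp
    qed
  next
    show "disjoint_family_on e' ?D"
      unfolding disjoint_family_on_def
    proof (intro ballI impI)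
      fix c d assume c: "c \<in> ?D" and d: "d \<in> ?D" and "c \<noteq> d"
      from kinds[OF c] show "e' c \<inter> e' d = {}"
      proof (elim disjE exE conjE)
        assume c1: "c \<in> Y" "e' c = f"
        then have "d \<notin> Y" using Y \<open>c \<noteq> d\<close> by blast
        from kinds[OF d] show ?thesis
        proof (elim disjE exE conjE)
          assume "d \<in> D - (x ` {..<L} \<union> Y)" "e' d = e d"
          then show ?thesis using f(1) c1 by auto
        qed (use c1 f_switch \<open>d \<notin> Y\<close> in auto)
      next
        fix i assume c1: "i < L" "c = x i" "e' c = switch (u i) (r i)"
        from kinds[OF d] show ?thesis
        proof (elim disjE exE conjE)
          fix j assume "j < L" "d = x j" "e' d = switch (u j) (r j)"
          then show ?thesis using switch_switch[of i j] c1 \<open>c \<noteq> d\<close> by auto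
        next
          assume "d \<in> D - (x ` {..<L} \<union> Y)" "e' d = e d"
          then show ?thesis using e_switch[OF c1(1)] c1(3) by (simp add: Int_commute)
        qed (use c1 f_switch in auto)
      next
        assume c1: "c \<in> D - (x ` {..<L} \<union> Y)" "e' c = e c"
        from kinds[OF d] show ?thesis
        proof (elim disjE exE conjE)
          assume "d \<in> D - (x ` {..<L} \<union> Y)" "e' d = e d"
          then show ?thesis using e_disj[of c d] c1 \<open>c \<noteq> d\<close> by auto
        next
          fix j assume "j < L" "e' d = switch (u j) (r j)"
          then show ?thesis using e_switch c1 by simp
        qed (use c1 f(1) in auto)
      qed
    qed
  qed
  then have "card ?D \<le> card D"
    by (rule maximal)
  moreover have "finite ?D"
    using finite_D Y by (auto intro: finite_subset)
  ultimately show False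
    using new card_seteq[of ?D D] by auto
qed

text \<open>A colour \<open>x i\<close> may take over either of two vertices of the edge of the next colour,
  so every colour on the path can be freed, with a choice left at each step.\<close>

definition switching_path :: "nat \<Rightarrow> (nat \<Rightarrow> nat) \<Rightarrow> bool" where
  "switching_path l x \<longleftrightarrow> inj_on x {..l} \<and> x 0 \<in> {1..t} - D \<and>
     (\<forall>i<l. x (Suc i) \<in> D \<and> (\<exists>u\<in>e (x (Suc i)). \<exists>u'\<in>e (x (Suc i)). u \<noteq> u' \<and>
        k + i < card (rows (x i) u) \<and> k + i < card (rows (x i) u')))"

section \<open>Consequences of maximality along switching paths\<close>

text \<open>One of the two vertices on offer at each step differs from \<open>z\<close>. This
  reserves \<open>z\<close> for a further switch by the last colour. The choices are distinct
  because they lie on edges of distinct colours in \<open>D\<close>.\<close>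

lemma switching_path_choice:
  assumes "switching_path l x"
  obtains u where "\<And>i. i < l \<Longrightarrow> u i \<in> e (x (Suc i)) \<and> u i \<noteq> z \<and> k + i < card (rows (x i) (u i))"
    and "inj_on u {..<l}"
proof -
  have "\<forall>i<l. \<exists>u. u \<in> e (x (Suc i)) \<and> u \<noteq> z \<and> k + i < card (rows (x i) u)"
    using assms unfolding switching_path_def by metis
  then obtain u where u: "\<And>i. i < l \<Longrightarrow> u i \<in> e (x (Suc i)) \<and> u i \<noteq> z \<and> k + i < card (rows (x i) (u i))"
    by metis
  have "inj_on u {..<l}"
  proof (rule inj_onI)
    fix i j assume ij: "i \<in> {..<l}" "j \<in> {..<l}" "u i = u j"
    have "x (Suc i) = x (Suc j)"
      using ij u[of i] u[of j] assms
      by (intro e_disj[of _ _ "u i"]) (auto simp: switching_path_def)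
    then have "Suc i = Suc j"
      using assms ij by (auto simp: switching_path_def dest: inj_onD[of x "{..l}" "Suc i" "Suc j"])
    then show "i = j" by simp
  qed
  with u show thesis by (rule that)
qed

lemma switching_path_mem:
  assumes "switching_path l x" "i \<le> l"
  shows "x i \<in> {1..t}"
proof (cases i)
  case 0
  then show ?thesis using assms by (auto simp: switching_path_def)
next
  case (Suc j)
  then have "x i \<in> D" using assms by (auto simp: switching_path_def)
  then show ?thesis using D_sub by blast
qed

lemma switching_path_prefix:
  assumes "switching_path l x" "i \<le> l"
  shows "switching_path i x"
  using assms by (auto simp: switching_path_def intro: inj_on_subset)

lemma switching_path_no_uncovered_edge:
  assumes p: "switching_path l x" and f: "f \<in> E (x l)"
  shows "f \<inter> covered \<noteq> {}"
proof
  assume cov: "f \<inter> covered = {}"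
  \<comment> \<open>No vertex has to be reserved here, so the arbitrary value
    \<open>undefined\<close> is the one avoided.\<close>
  obtain u where u: "\<And>i. i < l \<Longrightarrow> u i \<in> e (x (Suc i)) \<and> u i \<noteq> undefined \<and> k + i < card (rows (x i) (u i))"
    and inj: "inj_on u {..<l}"
    using switching_path_choice[OF p] by metis
  have "x ` {..<l} \<union> {x l} \<subseteq> D"
  proof (rule no_augmentation[where u = u and f = f and y = "x l"])
    show "inj_on x {..<l}"
      using p by (auto simp: switching_path_def intro: inj_on_subset)
    show "x i \<in> {1..t}" if "i < l" for i
      using switching_path_mem[OF p] that by simp
    show "\<exists>y\<in>(x ` {..<l} \<union> {x l}) \<inter> D. u i \<in> e y" if "i < l" for i
    proof (intro bexI[of _ "x (Suc i)"])
      show "x (Suc i) \<in> (x ` {..<l} \<union> {x l}) \<inter> D"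
        using that p by (cases "Suc i = l") (auto simp: switching_path_def)
    qed (use u that in blast)
    show "finite f" "card f \<le> k"
      using f finite_edge[of "x l" f] edge_card[of "x l" f] switching_path_mem[OF p, of l] by auto
    show "y \<in> {1..t} \<and> f \<in> E y" if "y \<in> {x l}" for y
      using that f switching_path_mem[OF p] by auto
  qed (use u inj cov in auto)
  moreover have "x 0 \<in> x ` {..<l} \<union> {x l}"
    by (cases l) auto
  ultimately show False
    using p by (auto simp: switching_path_def)
qed

text \<open>Otherwise \<open>x l\<close> could take over \<open>z\<close>, which frees
  \<open>c\<close> to move to \<open>f\<close>, and the family would gain
  \<open>x 0\<close>.\<close>

lemma switching_path_uncovered_colour:
  assumes p: "switching_path l x" and c: "c \<in> D" "f \<in> E c" "f \<inter> covered = {}" and z: "z \<in> e c"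
  shows "card (rows (x l) z) \<le> k + l"
proof (rule ccontr)
  assume big: "\<not> card (rows (x l) z) \<le> k + l"
  obtain u where u: "\<And>i. i < l \<Longrightarrow> u i \<in> e (x (Suc i)) \<and> u i \<noteq> z \<and> k + i < card (rows (x i) (u i))"
    and inj: "inj_on u {..<l}"
    using switching_path_choice[OF p] by metis
  let ?u = "u(l := z)"
  have "x ` {..<Suc l} \<union> {c} \<subseteq> D"
  proof (rule no_augmentation[where u = ?u and f = f and y = c])
    show "inj_on x {..<Suc l}"
      using p by (simp add: switching_path_def lessThan_Suc_atMost)
    show "x i \<in> {1..t}" if "i < Suc l" for i
      using switching_path_mem[OF p] that by simp
    show "inj_on ?u {..<Suc l}"
    proof -
      have "z \<notin> u ` {..<l}"
        using u by blast
      then show ?thesis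
        using inj inj_on_fun_updI[of u "{..<l}" z l] by (auto simp: lessThan_Suc)
    qed
    show "\<exists>y\<in>(x ` {..<Suc l} \<union> {c}) \<inter> D. ?u i \<in> e y" if "i < Suc l" for i
    proof (cases "i = l")
      case True
      then show ?thesis using z c by (intro bexI[of _ c]) auto
    next
      case False
      then have "x (Suc i) \<in> x ` {..<Suc l} \<inter> D"
        using that p by (auto simp: switching_path_def)
      then show ?thesis
        using u[of i] False that by (intro bexI[of _ "x (Suc i)"]) auto
    qed
    show "k + i < card (rows (x i) (?u i))" if "i < Suc l" for i
      using that u big by (cases "i = l") auto
    have ct: "c \<in> {1..t}"
      using c(1) D_sub by blast
    then show "finite f" "card f \<le> k"
      using c finite_edge[of c f] edge_card[of c f] by auto
    show "y \<in> {1..t} \<and> f \<in> E y" if "y \<in> {c}" for y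
      using that ct c by auto
  qed (use c in auto)
  then show False
    using p by (auto simp: switching_path_def)
qed

text \<open>Otherwise \<open>x l\<close> could take over \<open>z\<close> while \<open>x j\<close>
  uses its other vertex on the same edge, whose colour \<open>x (Suc j)\<close> moves away. This is
  where two vertices per step are needed.\<close>

lemma switching_path_revisit:
  assumes p: "switching_path l x" and j: "j < l" and z: "z \<in> e (x (Suc j))"
  shows "card (rows (x l) z) \<le> k + l"
proof (rule ccontr)
  assume big: "\<not> card (rows (x l) z) \<le> k + l"
  obtain u where u: "\<And>i. i < l \<Longrightarrow> u i \<in> e (x (Suc i)) \<and> u i \<noteq> z \<and> k + i < card (rows (x i) (u i))"
    and inj: "inj_on u {..<l}"
    using switching_path_choice[OF p] by metis
  let ?u = "u(l := z)"
  have xD: "x (Suc i) \<in> x ` {..<Suc l} \<inter> D" if "i < l" for i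
    using that p by (auto simp: switching_path_def)
  \<comment> \<open>The empty set is \<open>Y\<close>: only switches take place, with no move to an
    uncovered edge.\<close>
  have "x ` {..<Suc l} \<union> {} \<subseteq> D"
  proof (rule no_augmentation[where u = ?u and f = "{}"])
    show "inj_on x {..<Suc l}"
      using p by (simp add: switching_path_def lessThan_Suc_atMost)
    show "x i \<in> {1..t}" if "i < Suc l" for i
      using switching_path_mem[OF p] that by simp
    show "inj_on ?u {..<Suc l}"
    proof -
      have "z \<notin> u ` {..<l}"
        using u by blast
      then show ?thesis
        using inj inj_on_fun_updI[of u "{..<l}" z l] by (auto simp: lessThan_Suc)
    qed
    show "\<exists>y\<in>(x ` {..<Suc l} \<union> {}) \<inter> D. ?u i \<in> e y" if "i < Suc l" for i
    proof (cases "i = l")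
      case True
      then show ?thesis using z xD[OF j] by (intro bexI[of _ "x (Suc j)"]) auto
    next
      case False
      then show ?thesis
        using u[of i] xD[of i] that by (intro bexI[of _ "x (Suc i)"]) auto
    qed
    show "k + i < card (rows (x i) (?u i))" if "i < Suc l" for i
      using that u big by (cases "i = l") auto
  qed auto
  then show False
    using p by (auto simp: switching_path_def)
qed

section \<open>Double counting of rows\<close>

lemma switch_eq:
  assumes "i \<in> {1..k}" "u \<in> V i"
  shows "switch u r = insert u ((\<lambda>j. g j r) ` ({1..k} - {i}))"
proof -
  have "{g j r |j. j \<in> {1..k} \<and> u \<notin> V j} = (\<lambda>j. g j r) ` {j \<in> {1..k}. u \<notin> V j}"
    by blast
  moreover have "u \<in> V j \<longleftrightarrow> j = i" if "j \<in> {1..k}" for j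
    using V_unique[OF that assms(1) _ assms(2)] assms(2) by blast
  then have "{j \<in> {1..k}. u \<notin> V j} = {1..k} - {i}"
    by blast
  ultimately show ?thesis
    by (simp add: switch_def)
qed

lemma card_row:
  assumes "J \<subseteq> {1..k}" "r < w"
  shows "card ((\<lambda>j. g j r) ` J) = card J"
proof (intro card_image inj_onI)
  fix i j assume "i \<in> J" "j \<in> J" "g i r = g j r"
  then show "i = j" using g_eqD[of i r j r] assms by blast
qed

lemma row_crossing:
  assumes "J \<subseteq> {1..k}" "r < w"
  shows "(\<lambda>j. g j r) ` J \<in> crossing_tuples k V (card J)"
proof -
  have "card ((\<lambda>j. g j r) ` J \<inter> V i) \<le> 1" if "i \<in> {1..k}" for i
  proof -
    have "(\<lambda>j. g j r) ` J \<inter> V i \<subseteq> {g i r}"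
    proof
      fix z assume "z \<in> (\<lambda>j. g j r) ` J \<inter> V i"
      then obtain j where j: "j \<in> J" "z = g j r" "z \<in> V i" by blast
      then have "j = i"
        using V_unique[of j i z] g_mem[of j r] assms that by blast
      then show "z \<in> {g i r}" using j by simp
    qed
    from card_mono[OF _ this] show ?thesis by simp
  qed
  moreover have "(\<lambda>j. g j r) ` J \<subseteq> class_union k V"
    using g_mem[of _ r] assms unfolding class_union_def by blast
  moreover have "finite J"
    using assms(1) finite_subset by blast
  ultimately show ?thesis
    using card_row[OF assms] by (simp add: crossing_tuples_def crossing_def)
qed

text \<open>The single vertex of \<open>f\<close> in \<open>V i\<close> and the \<open>k - 1\<close>
  row vertices outside \<open>V i\<close> already exhaust \<open>f\<close>.\<close>

lemma edge_eq_switch: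
  assumes f: "c \<in> {1..t}" "f \<in> E c" and "i \<in> {1..k}" "r < w"
    and sub: "(\<lambda>j. g j r) ` ({1..k} - {i}) \<subseteq> f"
  obtains u where "u \<in> V i" "f = switch u r"
proof -
  obtain u where u: "f \<inter> V i = {u}"
    using edge_V[OF f \<open>i \<in> {1..k}\<close>] card_1_singletonE by blast
  let ?S = "(\<lambda>j. g j r) ` ({1..k} - {i})"
  have "u \<notin> ?S"
  proof
    assume "u \<in> ?S"
    then obtain j where "j \<in> {1..k} - {i}" "u = g j r" by blast
    then show False using V_unique[of i j u] g_mem[of j r] assms u by blast
  qed
  moreover have "card ?S = k - 1"
    using card_row[of "{1..k} - {i}" r] assms by simp
  moreover have "k \<ge> 1"
    using \<open>i \<in> {1..k}\<close> by simp
  ultimately have "card (insert u ?S) = k"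
    by simp
  then have "insert u ?S = f"
    using sub u edge_card[OF f] finite_edge[OF f] by (intro card_seteq) auto
  then have "f = switch u r"
    using u switch_eq[OF \<open>i \<in> {1..k}\<close>] by blast
  then show thesis using that u by blast
qed

lemma covered_sub: "covered \<subseteq> class_union k V"
proof (rule UN_least)
  fix c assume "c \<in> D"
  then show "e c \<subseteq> class_union k V"
    using edge_sub[of c "e c"] e_edge[of c] subsetD[OF D_sub, of c] by simp
qed

lemma finite_covered: "finite covered"
proof (rule finite_UN_I[OF finite_D])
  fix c assume "c \<in> D"
  then show "finite (e c)"
    using finite_edge[of c "e c"] e_edge[of c] subsetD[OF D_sub, of c] by simp
qed

text \<open>Pairs of a row and a covered vertex are counted twice. Each row without its vertex in
  \<open>V i\<close> lies in at least \<open>d\<close> edges; each of them meets the covered set,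
  and can do so only in its vertex in \<open>V i\<close>.\<close>

lemma sum_rows_class:
  assumes c: "c \<in> {1..t}" "\<And>f. f \<in> E c \<Longrightarrow> f \<inter> covered \<noteq> {}"
    and i: "i \<in> {1..k}"
    and deg: "\<And>S. S \<in> crossing_tuples k V (k - 1) \<Longrightarrow> avoids S (V i) \<Longrightarrow>
      d \<le> card {f \<in> E c. S \<subseteq> f}"
  shows "d * w \<le> (\<Sum>u\<in>covered \<inter> V i. card (rows c u))"
proof -
  let ?U = "covered \<inter> V i"
  have fin: "finite ?U"
    using finite_covered by blast
  have d: "d \<le> card {u \<in> ?U. switch u r \<in> E c}" if r: "r < w" for r
  proof -
    let ?S = "(\<lambda>j. g j r) ` ({1..k} - {i})"
    have "?S \<in> crossing_tuples k V (k - 1)"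
      using row_crossing[of "{1..k} - {i}" r] r i by simp
    moreover have "avoids ?S (V i)"
      using V_unique[OF _ i] g_mem[of _ r] r unfolding avoids_def by blast
    ultimately have "d \<le> card {f \<in> E c. ?S \<subseteq> f}"
      by (rule deg)
    also have "{f \<in> E c. ?S \<subseteq> f} \<subseteq> (\<lambda>u. switch u r) ` {u \<in> ?U. switch u r \<in> E c}"
    proof
      fix f assume "f \<in> {f \<in> E c. ?S \<subseteq> f}"
      then have f: "f \<in> E c" "?S \<subseteq> f" by auto
      obtain u where u: "u \<in> V i" "f = switch u r"
        using edge_eq_switch[OF c(1) f(1) i r f(2)] by blast
      obtain z where "z \<in> f" "z \<in> covered"
        using c(2)[OF f(1)] by blast
      then have "u \<in> covered"
        using switch_covered[of z u r] u(2) r by blast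
      then show "f \<in> (\<lambda>u. switch u r) ` {u \<in> ?U. switch u r \<in> E c}"
        using u f(1) by blast
    qed
    then have "card {f \<in> E c. ?S \<subseteq> f} \<le> card {u \<in> ?U. switch u r \<in> E c}"
      using finite_subset[OF _ fin, of "{u \<in> ?U. switch u r \<in> E c}"] by (intro surj_card_le) blast+
    finally show ?thesis .
  qed
  have "d * w = (\<Sum>r<w. d)"
    by simp
  also have "\<dots> \<le> (\<Sum>r<w. card {u \<in> ?U. switch u r \<in> E c})"
    using d by (intro sum_mono) auto
  also have "\<dots> = (\<Sum>u\<in>?U. card (rows c u))"
    using fin by (intro sum_multicount_gen) (auto simp: rows_def)
  finally show ?thesis .
qed

text \<open>The covered set is partitioned both by the classes and by the matching edges, so the
  bounds for the classes add up and regroup by colour.\<close>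

lemma sum_rows_ge:
  assumes c: "c \<in> {1..t}" "\<And>f. f \<in> E c \<Longrightarrow> f \<inter> covered \<noteq> {}"
    and deg: "\<And>i S. i \<in> {1..k} \<Longrightarrow> S \<in> crossing_tuples k V (k - 1) \<Longrightarrow> avoids S (V i) \<Longrightarrow>
      a i \<le> card {f \<in> E c. S \<subseteq> f}"
  shows "(\<Sum>i\<in>{1..k}. a i) * w \<le> (\<Sum>b\<in>D. \<Sum>u\<in>e b. card (rows c u))"
proof -
  have "(\<Sum>i\<in>{1..k}. a i) * w \<le> (\<Sum>i\<in>{1..k}. \<Sum>u\<in>covered \<inter> V i. card (rows c u))"
    unfolding sum_distrib_right by (intro sum_mono sum_rows_class c deg) auto
  also have "\<dots> = (\<Sum>u\<in>(\<Union>i\<in>{1..k}. covered \<inter> V i). card (rows c u))"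
  proof (rule sum.UNION_disjoint[symmetric, OF finite_atLeastAtMost]; intro ballI impI)
    show "covered \<inter> V i \<inter> (covered \<inter> V j) = {}" if "i \<in> {1..k}" "j \<in> {1..k}" "i \<noteq> j" for i j
      using V_unique[OF that(1,2)] that(3) by blast
  qed (use finite_covered in auto)
  also have "(\<Union>i\<in>{1..k}. covered \<inter> V i) = covered"
    using covered_sub unfolding class_union_def by blast
  also have "(\<Sum>u\<in>covered. card (rows c u)) = (\<Sum>b\<in>D. \<Sum>u\<in>e b. card (rows c u))"
  proof (rule sum.UNION_disjoint[OF finite_D]; intro ballI impI)
    show "finite (e b)" if "b \<in> D" for b
      using finite_covered that by (auto intro: finite_subset)
    show "e b \<inter> e b' = {}" if "b \<in> D" "b' \<in> D" "b \<noteq> b'" for b b'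
      using e_disj[OF that(1,2)] that(3) by blast
  qed
  finally show ?thesis .
qed

section \<open>Extending switching paths and the size of the family\<close>

text \<open>Without an extension, \<open>x l\<close> collects roughly \<open>w\<close> or less from
  each edge outside \<open>C \<union> P\<close> and little elsewhere. There are too few such edges
  to reach the total forced by the degrees.\<close>

lemma switching_path_extend:
  assumes p: "switching_path l x"
    and deg: "\<And>i S. i \<in> {1..k} \<Longrightarrow> S \<in> crossing_tuples k V (k - 1) \<Longrightarrow> avoids S (V i) \<Longrightarrow>
      a i \<le> card {f \<in> E (x l). S \<subseteq> f}"
    and m: "m \<le> card {c \<in> D. \<exists>f\<in>E c. f \<inter> covered = {}}"
    and small: "card D < m + (\<Sum>i\<in>{1..k}. a i)"
    and w: "card D * k\<^sup>2 < w"
    and k: "k \<ge> 1"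
  shows "\<exists>y. switching_path (Suc l) (x(Suc l := y))"
proof (rule ccontr)
  assume no: "\<nexists>y. switching_path (Suc l) (x(Suc l := y))"
  define C where "C = {c \<in> D. \<exists>f\<in>E c. f \<inter> covered = {}}"
  define P where "P = x ` {Suc 0..l}"
  let ?N = "\<lambda>u. card (rows (x l) u)"
  have CD: "C \<subseteq> D"
    by (auto simp: C_def)
  have x_inj: "inj_on x {..l}" and x0: "x 0 \<in> {1..t} - D"
    using p by (auto simp: switching_path_def)
  have P_eq: "\<exists>i<l. c = x (Suc i)" if "c \<in> P" for c
  proof -
    obtain j where "j \<in> {Suc 0..l}" "c = x j" using \<open>c \<in> P\<close> unfolding P_def by blast
    then show ?thesis by (intro exI[of _ "j - 1"]) auto
  qed
  have PD: "P \<subseteq> D"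
  proof
    fix c assume "c \<in> P"
    then obtain i where "i < l" "c = x (Suc i)" using P_eq by blast
    then show "c \<in> D" using p by (simp add: switching_path_def)
  qed
  \<comment> \<open>Each colour in \<open>P\<close> ends a shorter switching path, so it has no
    uncovered edge. Hence the sizes of \<open>C\<close> and \<open>P\<close> add up.\<close>
  have CP: "C \<inter> P = {}"
  proof (rule ccontr)
    assume "C \<inter> P \<noteq> {}"
    then obtain c where "c \<in> C" "c \<in> P" by blast
    moreover then obtain i where "i < l" "c = x (Suc i)" using P_eq by blast
    ultimately obtain f where "i < l" "f \<in> E (x (Suc i))" "f \<inter> covered = {}"
      by (auto simp: C_def)
    then show False
      using switching_path_no_uncovered_edge[OF switching_path_prefix[OF p, of "Suc i"]] by auto
  qed
  have "card P = l"
    unfolding P_def using x_inj by (subst card_image) (auto intro: inj_on_subset)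
  then have card_CP: "card (C \<union> P) = card C + l"
    using CP CD PD finite_D by (subst card_Un_disjoint) (auto intro: finite_subset)
  have finite_e: "finite (e c)" and card_e: "card (e c) = k" if "c \<in> D" for c
    using that e_edge[of c] D_sub finite_edge[of c "e c"] edge_card[of c "e c"] by auto
  have low: "(\<Sum>u\<in>e c. ?N u) \<le> k * (k + l)" if "c \<in> C \<union> P" for c
  proof -
    have "?N u \<le> k + l" if "u \<in> e c" for u
    proof (cases "c \<in> C")
      case True
      then obtain f where "c \<in> D" "f \<in> E c" "f \<inter> covered = {}"
        unfolding C_def by blast
      then show ?thesis
        using switching_path_uncovered_colour[OF p] that by blast
    next
      case False
      then obtain i where "i < l" "c = x (Suc i)"
        using P_eq \<open>c \<in> C \<union> P\<close> by blast
      then show ?thesis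
        using switching_path_revisit[OF p] that by blast
    qed
    then have "(\<Sum>u\<in>e c. ?N u) \<le> card (e c) * (k + l)"
      using sum_bounded_above[of "e c" ?N "k + l"] by simp
    moreover have "c \<in> D" using that CD PD by blast
    ultimately show ?thesis using card_e by simp
  qed
  have high: "(\<Sum>u\<in>e c. ?N u) \<le> w + k * (k + l)" if c: "c \<in> D - (C \<union> P)" for c
  proof -
    \<comment> \<open>Two such vertices would make \<open>c\<close> the next colour of the path; it
      is new, as it lies outside \<open>P\<close> and \<open>x 0\<close> is not in
      \<open>D\<close>.\<close>
    have unique: "u = u'" if u: "u \<in> e c" "u' \<in> e c" "k + l < ?N u" "k + l < ?N u'" for u u'
    proof (rule ccontr)
      assume "u \<noteq> u'"
      have "c \<notin> x ` {..l}"
      proof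
        assume "c \<in> x ` {..l}"
        then obtain j where j: "j \<le> l" "c = x j" by blast
        then show False using c x0 by (cases j) (auto simp: P_def)
      qed
      then have "inj_on (x(Suc l := c)) {..Suc l}"
        using inj_on_fun_updI[OF x_inj, of c "Suc l"] by (simp add: atMost_Suc image_iff)
      then have "switching_path (Suc l) (x(Suc l := c))"
        using p c u \<open>u \<noteq> u'\<close> by (auto simp: switching_path_def less_Suc_eq)
      then show False using no by blast
    qed
    have "(\<Sum>u\<in>e c. ?N u) \<le> (\<Sum>u\<in>e c. (if k + l < ?N u then w else 0) + (k + l))"
      using card_rows_le by (intro sum_mono) (auto intro: trans_le_add1)
    also have "\<dots> = card {u \<in> e c. k + l < ?N u} * w + card (e c) * (k + l)"
      using finite_e[of c] c by (simp add: sum.distrib sum.If_cases Int_def)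
    also have "card {u \<in> e c. k + l < ?N u} \<le> 1"
      using unique finite_e[of c] c by (subst One_nat_def, subst card_le_Suc0_iff_eq) auto
    finally show ?thesis
      using card_e[of c] c by (simp add: mult_le_mono1)
  qed
  have "(\<Sum>i\<in>{1..k}. a i) * w \<le> (\<Sum>c\<in>D. \<Sum>u\<in>e c. ?N u)"
    using switching_path_mem[OF p order_refl] switching_path_no_uncovered_edge[OF p] deg
    by (rule sum_rows_ge)
  also have "\<dots> \<le> (\<Sum>c\<in>D. (if c \<in> C \<union> P then 0 else w) + k * (k + l))"
    using low high by (intro sum_mono) auto
  also have "\<dots> = card (D - (C \<union> P)) * w + card D * (k * (k + l))"
    using finite_D by (simp add: sum.distrib sum.If_cases Diff_eq Compl_eq)
  finally have 1: "(\<Sum>i\<in>{1..k}. a i) * w \<le> card (D - (C \<union> P)) * w + card D * (k * (k + l))" .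
  have "card (D - (C \<union> P)) + (card C + l) = card D"
    using card_CP CD PD finite_D card_Diff_subset[of "C \<union> P" D] card_mono[of D "C \<union> P"]
      finite_subset[of "C \<union> P" D]
    by simp
  \<comment> \<open>The strict inequality \<open>small\<close> supplies the extra 1, without which
    \<open>l = 0\<close> would give no contradiction.\<close>
  then have "card (D - (C \<union> P)) + (l + 1) \<le> (\<Sum>i\<in>{1..k}. a i)"
    using m small unfolding C_def by linarith
  then have "(card (D - (C \<union> P)) + (l + 1)) * w \<le> (\<Sum>i\<in>{1..k}. a i) * w"
    by (rule mult_le_mono1)
  with 1 have 2: "(l + 1) * w \<le> card D * (k * (k + l))"
    by (simp add: algebra_simps)
  \<comment> \<open>This bounds the error by \<open>l + 1\<close> times
    \<open>card D * k\<^sup>2\<close>, so one condition on \<open>w\<close> serves all lengths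
    \<open>l\<close>.\<close>
  have "k + l \<le> k * (l + 1)"
    using k by (cases k) auto
  then have "card D * (k * (k + l)) \<le> card D * (k * (k * (l + 1)))"
    by (intro mult_le_mono2)
  also have "\<dots> = (l + 1) * (card D * k\<^sup>2)"
    by (simp add: power2_eq_square algebra_simps)
  also have "\<dots> < (l + 1) * w"
    using w by (intro mult_strict_left_mono) auto
  finally show False using 2 by simp
qed

text \<open>A smaller family would admit switching paths of every length, although all colours after
  the first are distinct elements of the finite set \<open>D\<close>.\<close>

lemma card_maximum_rainbow:
  assumes deg: "\<And>c i S. c \<in> {1..t} \<Longrightarrow> i \<in> {1..k} \<Longrightarrow> S \<in> crossing_tuples k V (k - 1) \<Longrightarrow>
      avoids S (V i) \<Longrightarrow> a i \<le> card {f \<in> E c. S \<subseteq> f}"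
    and common: "\<And>S. S \<in> crossing_tuples k V k \<Longrightarrow> m \<le> card {c \<in> {1..t}. S \<in> E c}"
    and t: "m + (\<Sum>i\<in>{1..k}. a i) \<le> t"
    and w: "card D * k\<^sup>2 < w"
    and k: "k \<ge> 1"
  shows "m + (\<Sum>i\<in>{1..k}. a i) \<le> card D"
proof (rule ccontr)
  assume less: "\<not> m + (\<Sum>i\<in>{1..k}. a i) \<le> card D"
  let ?C = "{c \<in> D. \<exists>f\<in>E c. f \<inter> covered = {}}"
  let ?S = "(\<lambda>j. g j 0) ` {1..k}"
  have w0: "0 < w"
    using w by simp
  have "m \<le> card {c \<in> {1..t}. ?S \<in> E c}"
    using row_crossing[of "{1..k}" 0] w0 by (intro common) simp
  also have "\<dots> \<le> card ?C"
  proof (rule card_mono)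
    show "finite ?C"
      using finite_D by simp
    show "{c \<in> {1..t}. ?S \<in> E c} \<subseteq> ?C"
    proof
      fix c assume "c \<in> {c \<in> {1..t}. ?S \<in> E c}"
      then have c: "c \<in> {1..t}" "?S \<in> E c" by auto
      have S: "?S \<inter> covered = {}"
        using g_mem[of _ 0] w0 by blast
      have "c \<in> D"
      proof (rule ccontr)
        assume "c \<notin> D"
        then have "switching_path 0 (\<lambda>_. c)"
          using c by (simp add: switching_path_def)
        then show False
          using switching_path_no_uncovered_edge[of 0 "\<lambda>_. c"] c S by blast
      qed
      then show "c \<in> ?C" using c S by blast
    qed
  qed
  finally have m: "m \<le> card ?C" .
  have "\<exists>x. switching_path l x" for l
  proof (induction l)
    case 0
    have "card D < card {1..t}"
      using less t by simp
    then obtain c where "c \<in> {1..t} - D"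
      using D_sub by (metis Diff_eq_empty_iff ex_in_conv subset_antisym less_irrefl)
    then show ?case
      by (intro exI[of _ "\<lambda>_. c"]) (simp add: switching_path_def)
  next
    case (Suc l)
    then obtain x where x: "switching_path l x" by blast
    have "\<exists>y. switching_path (Suc l) (x(Suc l := y))"
      using less switching_path_mem[OF x order_refl]
      by (intro switching_path_extend[OF x deg m _ w k]) auto
    then show ?case by blast
  qed
  then obtain x where x: "switching_path (Suc (card D)) x" by blast
  have "card ((\<lambda>i. x (Suc i)) ` {..<Suc (card D)}) \<le> card D"
    using x finite_D by (intro card_mono) (auto simp: switching_path_def)
  moreover have "inj_on (\<lambda>i. x (Suc i)) {..<Suc (card D)}"
    using x unfolding switching_path_def inj_on_def by force
  ultimately show False
    by (simp add: card_image)
qed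

end

section \<open>Return to hypergraphs\<close>

text \<open>As \<open>k \<ge> 1\<close>, the edges are nonempty, so disjointness makes
  \<open>e\<close> injective and its inverse recovers the colours.\<close>

lemma rainbow_matching_of_family:
  assumes "rainbow_family t (\<lambda>c. edges (H c)) D e" "r \<le> card D" "k \<ge> 1"
    and edge: "\<And>c f. c \<in> {1..t} \<Longrightarrow> f \<in> edges (H c) \<Longrightarrow> f \<subseteq> X \<and> card f = k"
  shows "\<exists>M. rainbow_matching k X t H M \<and> card M = r"
proof -
  obtain B where B: "B \<subseteq> D" "card B = r"
    using obtain_subset_with_card_n[OF assms(2)] by blast
  have D: "D \<subseteq> {1..t}" "\<And>c. c \<in> D \<Longrightarrow> e c \<in> edges (H c)"
    and disj: "\<And>c d. c \<in> D \<Longrightarrow> d \<in> D \<Longrightarrow> c \<noteq> d \<Longrightarrow> e c \<inter> e d = {}"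
    using assms(1) unfolding rainbow_family_def disjoint_family_on_def by blast+
  have ne: "e c \<noteq> {}" if "c \<in> D" for c
    using edge[of c "e c"] D that assms(3) by force
  have inj: "inj_on e B"
  proof (rule inj_onI)
    fix c d assume "c \<in> B" "d \<in> B" "e c = e d"
    then show "c = d" using disj[of c d] ne[of c] B by blast
  qed
  have "rainbow_matching k X t H (e ` B)"
    unfolding rainbow_matching_def
  proof (intro conjI exI[of _ "the_inv_into B e"])
    show "\<forall>f\<in>e ` B. f \<subseteq> X \<and> card f = k"
      using edge D B by blast
    show "pairwise disjnt (e ` B)"
      using disj B unfolding pairwise_def disjnt_def by blast
    show "inj_on (the_inv_into B e) (e ` B)"
      using inj by (rule inj_on_the_inv_into)
    show "the_inv_into B e ` e ` B \<subseteq> {1..t}"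
      using inj B D by (auto simp: the_inv_into_f_f)
    show "\<forall>f\<in>e ` B. f \<in> edges (H (the_inv_into B e f))"
      using inj B D by (auto simp: the_inv_into_f_f)
  qed
  moreover have "card (e ` B) = r"
    using inj B by (simp add: card_image)
  ultimately show ?thesis by blast
qed

lemma min_deg_avoiding_le:
  assumes "\<And>i. i \<in> {1..k} \<Longrightarrow> finite (V i)" "S \<in> crossing_tuples k V (k - 1)" "avoids S (V i)"
  shows "min_deg_avoiding k V i H \<le> hdeg H S"
proof -
  have "finite (class_union k V)"
    using assms(1) by (auto simp: class_union_def)
  then have "finite (crossing_tuples k V (k - 1))"
    by (rule finite_subset[rotated, OF finite_Pow_iff[THEN iffD2]])
      (auto simp: crossing_tuples_def crossing_def)
  then have "finite {hdeg H S |S. S \<in> crossing_tuples k V (k - 1) \<and> avoids S (V i)}"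
    by simp
  then show ?thesis
    unfolding min_deg_avoiding_def using assms(2,3) by (intro Min_le) auto
qed

theorem lemma2p5:
  fixes k n t m q :: nat
    and a :: "nat \<Rightarrow> nat"
    and V :: "nat \<Rightarrow> 'a set"
    and H :: "nat \<Rightarrow> 'a hypergraph"
  assumes "k \<ge> 1" and "n \<ge> 1"
    and "q = (\<Sum>i\<in>{1..k}. a i)"
    and "disjoint_family_on V {1..k}"
    and "\<And>i. i \<in> {1..k} \<Longrightarrow> finite (V i) \<and> card (V i) = n"
    and "\<And>j. j \<in> {1..t} \<Longrightarrow> k_graph k (H j) \<and> k_partite k V (H j)"
    and "\<And>i j. i \<in> {1..k} \<Longrightarrow> j \<in> {1..t} \<Longrightarrow> min_deg_avoiding k V i (H j) \<ge> a i"
    and "\<And>S. S \<in> crossing_tuples k V k \<Longrightarrow> card {j \<in> {1..t}. S \<in> edges (H j)} \<ge> m"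
    and "n \<ge> max (1600 * k ^ 4 * q) (100 * k ^ 6)"
    and "m + q \<le> t"
    and "real t \<le> (1 + 1 / (200 * real k)) * real q"
  shows "\<exists>M. rainbow_matching k (class_union k V) t H M \<and> card M = m + q"
proof -
  let ?E = "\<lambda>c. edges (H c)"
  have edge: "f \<subseteq> class_union k V \<and> card f = k" if "c \<in> {1..t}" "f \<in> ?E c" for c f
    using assms(6)[OF that(1)] that(2) by (auto simp: k_graph_def k_partite_def)
  have edge_V: "card (f \<inter> V i) = 1" if "c \<in> {1..t}" "f \<in> ?E c" "i \<in> {1..k}" for c f i
    using assms(6)[OF that(1)] that by (auto simp: k_partite_def)
  let ?P = "\<lambda>(D, e). rainbow_family t ?E D e"
  have "?P ({}, \<lambda>_. {})"
    by (simp add: rainbow_family_def disjoint_family_on_def)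
  moreover have bound: "card D \<le> t" if "rainbow_family t ?E D e" for D e
    using that card_mono[of "{1..t}" D] by (auto simp: rainbow_family_def)
  ultimately obtain De where "?P De" "\<And>De'. ?P De' \<Longrightarrow> card (fst De') \<le> card (fst De)"
    using ex_has_greatest_nat[of ?P "({}, \<lambda>_. {})" "\<lambda>De. card (fst De)" "Suc t"]
    by (force simp: less_Suc_eq_le)
  then obtain D e where rainbow: "rainbow_family t ?E D e"
    and maximal: "\<And>D' e'. rainbow_family t ?E D' e' \<Longrightarrow> card D' \<le> card D"
    by (cases De) force
  have D: "D \<subseteq> {1..t}" "\<And>c. c \<in> D \<Longrightarrow> e c \<in> ?E c" "disjoint_family_on e D"
    using rainbow by (auto simp: rainbow_family_def)
  have finD: "finite D"
    using D(1) finite_subset by blast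
  \<comment> \<open>The matching edges are disjoint and each has exactly one vertex in
    \<open>V i\<close>.\<close>
  have uncovered: "card (V i - \<Union> (e ` D)) = n - card D" if i: "i \<in> {1..k}" for i
  proof -
    have fin: "finite (V i)" "card (V i) = n"
      using assms(5)[OF i] by auto
    have "card (\<Union>c\<in>D. e c \<inter> V i) = (\<Sum>c\<in>D. card (e c \<inter> V i))"
      using finD fin D(3) by (intro card_UN_disjoint) (auto simp: disjoint_family_on_def)
    also have "\<dots> = card D"
      using edge_V D i by (subst sum.cong[OF refl, of D _ "\<lambda>_. 1"]) auto
    also have "(\<Union>c\<in>D. e c \<inter> V i) = V i \<inter> \<Union> (e ` D)"
      by blast
    finally have "card (V i \<inter> \<Union> (e ` D)) = card D" .
    then show ?thesis
      using card_Diff_subset_Int[of "V i" "\<Union> (e ` D)"] fin by simp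
  qed
  have "\<exists>h. bij_betw h {..<n - card D} (V i - \<Union> (e ` D))" if "i \<in> {1..k}" for i
    using ex_bij_betw_nat_finite[of "V i - \<Union> (e ` D)"] uncovered[OF that] assms(5)[OF that]
    by (auto simp: lessThan_atLeast0)
  then obtain g where g: "\<And>i. i \<in> {1..k} \<Longrightarrow> bij_betw (g i) {..<n - card D} (V i - \<Union> (e ` D))"
    by metis
  have mx: "maximum_rainbow k t (n - card D) V ?E D e g"
  proof
    show "finite (V i)" if "i \<in> {1..k}" for i
      using assms(5)[OF that] by simp
  qed (use assms(4) edge edge_V rainbow maximal g in simp_all)
  have "m + q \<le> card D"
  \<comment> \<open>For \<open>q = 0\<close> the upper bound on \<open>t\<close> forces
    \<open>t = 0\<close>, hence \<open>m = 0\<close>. The strict estimate in the other case relies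
    on \<open>q > 0\<close>.\<close>
  proof (cases "q = 0")
    case True
    then have "t = 0" using assms(11) by simp
    then show ?thesis using assms(10) by simp
  next
    case False
    have "1 / (200 * real k) \<le> 1"
      using assms(1) by (simp add: field_simps)
    then have "(1 + 1 / (200 * real k)) * real q \<le> 2 * real q"
      by (intro mult_right_mono) auto
    then have "t \<le> 2 * q"
      using assms(11) by linarith
    then have D2: "card D \<le> 2 * q"
      using bound[OF rainbow] by simp
    \<comment> \<open>With \<open>w = n - card D\<close>, the condition on \<open>w\<close> amounts
      to \<open>card D * (k\<^sup>2 + 1) < n\<close>.\<close>
    have "k\<^sup>2 \<le> k ^ 4" "1 \<le> k ^ 4"
      using assms(1) by (auto intro: power_increasing)
    then have "k\<^sup>2 + 1 \<le> 2 * k ^ 4" by linarith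
    then have "card D * (k\<^sup>2 + 1) \<le> (2 * q) * (2 * k ^ 4)"
      using D2 by (intro mult_le_mono)
    also have "\<dots> < 1600 * k ^ 4 * q"
      using False assms(1) by simp
    also have "\<dots> \<le> n"
      using assms(9) by simp
    finally have "card D * k\<^sup>2 < n - card D"
      by (simp add: algebra_simps)
    moreover have "a i \<le> card {f \<in> ?E c. S \<subseteq> f}"
      if "c \<in> {1..t}" "i \<in> {1..k}" "S \<in> crossing_tuples k V (k - 1)" "avoids S (V i)" for c i S
      using assms(7)[OF that(2,1)] min_deg_avoiding_le[of k V S i "H c"] assms(5) that
      by (force simp: hdeg_def)
    ultimately show ?thesis
      using maximum_rainbow.card_maximum_rainbow[OF mx, of a m] assms(1,3,8,10) by blast
  qed
  then show ?thesis
    by (rule rainbow_matching_of_family[OF rainbow _ assms(1)]) (rule edge)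
qed

end
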